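(* Let $K\ge1$ and $\tau=\tau^{K}\circ\cdots\circ\tau^{2}\circ\tau^{1}$, where for $k=1,\dots,K$, $\tau^k(\bm x)=T^k(L^k\bm x+\bm\mu^k)$ with $T^k(\bm y)=(T^k_1(y_1),\dots,T^k_d(y_d))$, each $T_i^k:\mathbb R\to\mathbb R$ strictly monotone, $L^k\in\mathbb R^{d\times d}$ lower-triangular, and $\bm\mu^k\in\mathbb R^d$. Suppose that there are common constants $c_T,C_T>0$, $M_T,B_T\ge0$ and $c_T',C_T'\in\mathbb R$ such that for all $1\le i\le d$, $1\le k\le K$ and $y\in\mathbb R$, $$|D^mT^k_i(y)|\le B_T\exp(M_T|y|^2)\ (1\le m\le d),\qquad c_T|y|^2+c_T'\le|T^k_i(y)|^2\le C_T|y|^2+C_T'.$$ Define $M_L:=\max_{1\le k\le K}\lambda_{\max}((L^k)^{\mathrm T}L^k)$ and $m_L:=\min_{1\le k\le K}\lambda_{\min}((L^k)^{\mathrm T}L^k)$, and assume $m_L>0$. Let $\varepsilon\in(0,1)$ be arbitrary (arbitrarily small), and put $$c_\tau=\big((1-\varepsilon)c_Tm_L\big)^K,\qquad C_*^{(k)}=\big((1+\varepsilon)C_TM_L\big)^k\ (k\ge0),\qquad C_\tau=C_*^{(K)},$$ $$M_\tau^{(0)}=0,\qquad M_\tau^{(k)}=(1+\varepsilon)M_TM_L\,C_*^{(k-1)}+d\,M_\tau^{(k-1)}\quad(k=1,\dots,K).$$ Then there exist constants $B_\tau\ge0$ and $C_\tau',c_\tau'\in\mathbb R$ such that for all $\bm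 x\in\mathbb R^d$: $$|D^{\bm a}\tau_i(\bm x)|\le B_\tau\exp\big(M_\tau^{(K)}\|\bm x\|^2\big)\quad\text{for all }1\le i\le d,\ \bm a\in\mathbb N_0^d,\ 1\le|\bm a|\le d,$$ $$\|\tau(\bm x)\|^2\le C_\tau\|\bm x\|^2+C_\tau',\qquad \|\tau(\bm x)\|^2\ge c_\tau\|\bm x\|^2+c_\tau'.$$
   Context: $\|\cdot\|$ is the Euclidean norm; $\lambda_{\max}(\cdot)$ and $\lambda_{\min}(\cdot)$ denote the largest and smallest eigenvalues. $\tau_i$ is the $i$-th component of $\tau$. For $\bm a\in\mathbb N_0^d$, $|\bm a|=a_1+\dots+a_d$ and $D^{\bm a}$ is the corresponding partial derivative; $D^mT^k_i$ is the $m$-th derivative (the maps $T^k_i$ are assumed $d$ times differentiable, as presupposed by the bounds). The constants $B_\tau,C_\tau',c_\tau'$ may depend on $\varepsilon$ and $K$. *)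

theory Defs
  imports "HOL-Analysis.Analysis"
begin

definition eigenvalue_of :: "real ^ 'n ^ 'n \<Rightarrow> real \<Rightarrow> bool" where
  "eigenvalue_of A l \<longleftrightarrow> (\<exists>v. v \<noteq> 0 \<and> A *v v = l *\<^sub>R v)"

(* Only used for symmetric matrices, whose real eigenvalues form a finite nonempty set,
   so that Max and Min are meaningful. *)
definition lambda_max :: "real ^ 'n ^ 'n \<Rightarrow> real" where
  "lambda_max A = Max {l. eigenvalue_of A l}"

definition lambda_min :: "real ^ 'n ^ 'n \<Rightarrow> real" where
  "lambda_min A = Min {l. eigenvalue_of A l}"

definition lower_triangular :: "real ^ 'n::{finite,linorder} ^ 'n::{finite,linorder} \<Rightarrow> bool" where
  "lower_triangular A \<longleftrightarrow> (\<forall>i j. i < j \<longrightarrow> A $ i $ j = 0)"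

definition strictly_monotone :: "(real \<Rightarrow> real) \<Rightarrow> bool" where
  "strictly_monotone f \<longleftrightarrow> strict_mono f \<or> strict_antimono_on UNIV f"

definition times_differentiable :: "nat \<Rightarrow> (real \<Rightarrow> real) \<Rightarrow> bool" where
  "times_differentiable n f \<longleftrightarrow> (\<forall>m<n. \<forall>y. (deriv ^^ m) f differentiable (at y))"

definition partial_deriv :: "'n::finite \<Rightarrow> (real ^ 'n::finite \<Rightarrow> real) \<Rightarrow> real ^ 'n::finite \<Rightarrow> real" where
  "partial_deriv i f x = deriv (\<lambda>t. f (x + t *\<^sub>R axis i 1)) 0"

(* n-fold (Frechet) differentiability: a derivative is itself differentiable
   iff its coordinates, the partial derivatives, are. *)
primrec times_differentiable_vec :: "nat \<Rightarrow> (real ^ 'n::finite \<Rightarrow> real) \<Rightarrow> bool" where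
  "times_differentiable_vec 0 f \<longleftrightarrow> True"
| "times_differentiable_vec (Suc n) f \<longleftrightarrow>
     (\<forall>x. f differentiable (at x)) \<and> (\<forall>i. times_differentiable_vec n (partial_deriv i f))"

(* With the index type enumerated as i1 < ... < id, this is
   (d/dx_i1)^(a i1) ... (d/dx_id)^(a id) f, the rightmost operator being applied first. *)
definition multi_deriv ::
    "('n::{finite,linorder} \<Rightarrow> nat) \<Rightarrow> (real ^ 'n::{finite,linorder} \<Rightarrow> real) \<Rightarrow> real ^ 'n::{finite,linorder} \<Rightarrow> real" where
  "multi_deriv a f =
     foldr (\<lambda>i g. (partial_deriv i ^^ a i) g) (sorted_list_of_set (UNIV :: 'n set)) f"

definition layer ::
    "('n \<Rightarrow> real \<Rightarrow> real) \<Rightarrow> real ^ 'n ^ 'n \<Rightarrow> real ^ 'n \<Rightarrow> real ^ 'n \<Rightarrow> real ^ 'n::finite" where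
  "layer T L \<mu> x = (\<chi> i. T i ((L *v x + \<mu>) $ i))"

primrec layers ::
    "(nat \<Rightarrow> 'n \<Rightarrow> real \<Rightarrow> real) \<Rightarrow> (nat \<Rightarrow> real ^ 'n ^ 'n) \<Rightarrow> (nat \<Rightarrow> real ^ 'n)
       \<Rightarrow> nat \<Rightarrow> real ^ 'n \<Rightarrow> real ^ 'n::finite" where
  "layers T L \<mu> 0 = id"
| "layers T L \<mu> (Suc k) = layer (T (Suc k)) (L (Suc k)) (\<mu> (Suc k)) \<circ> layers T L \<mu> k"

definition M_L :: "nat \<Rightarrow> (nat \<Rightarrow> real ^ 'n ^ 'n) \<Rightarrow> real" where
  "M_L K L = Max ((\<lambda>k. lambda_max (transpose (L k) ** L k)) ` {1..K})"

definition m_L :: "nat \<Rightarrow> (nat \<Rightarrow> real ^ 'n ^ 'n) \<Rightarrow> real" where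
  "m_L K L = Min ((\<lambda>k. lambda_min (transpose (L k) ** L k)) ` {1..K})"

definition C_star :: "real \<Rightarrow> real \<Rightarrow> real \<Rightarrow> nat \<Rightarrow> real" where
  "C_star \<epsilon> C_T ML k = ((1 + \<epsilon>) * C_T * ML) ^ k"

primrec M_tau :: "nat \<Rightarrow> real \<Rightarrow> real \<Rightarrow> real \<Rightarrow> real \<Rightarrow> nat \<Rightarrow> real" where
  "M_tau d \<epsilon> M_T C_T ML 0 = 0"
| "M_tau d \<epsilon> M_T C_T ML (Suc k) =
     (1 + \<epsilon>) * M_T * ML * C_star \<epsilon> C_T ML k + real d * M_tau d \<epsilon> M_T C_T ML k"

end

theory Submission
  imports Defs
begin

text \<open>
  The two-sided bounds on \<open>\<parallel>\<tau>(x)\<parallel>\<^sup>2\<close> are chained through the layers: the Rayleigh quotient of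
  \<open>L\<^sup>T L\<close> controls \<open>\<parallel>L y\<parallel>\<^sup>2\<close>, and Young's inequality absorbs the shift \<open>\<mu>\<close> at the price of \<open>1 \<plusminus> \<epsilon>\<close>.

  For the derivatives, let \<open>A\<close> be the exponent of \<open>T\<^sup>(\<^sup>m\<^sup>)(g)\<close>, where \<open>g\<close> is a coordinate of
  \<open>L \<tau>\<^sup>k\<^sup>-\<^sup>1 + \<mu>\<close>, and \<open>M\<close> a common exponent for all derivatives of \<open>g\<close>. In
  \<open>\<partial>\<^sub>i (T\<^sup>(\<^sup>m\<^sup>)(g)) = T\<^sup>(\<^sup>m\<^sup>+\<^sup>1\<^sup>)(g) \<partial>\<^sub>i g\<close> one differentiation costs one additional \<open>M\<close>, so derivatives of order
  \<open>j\<close> have exponent \<open>A + j M\<close>. This linear growth in \<open>j\<close> is stable under the Leibniz rule and replaces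
  Faa di Bruno's formula.
\<close>

section \<open>Rayleigh quotients\<close>

lemma symmetric_matrix_inner:
  fixes A :: "real ^ 'n ^ 'n"
  assumes "transpose A = A"
  shows "x \<bullet> (A *v y) = (A *v x) \<bullet> y"
  using assms by (metis dot_lmul_matrix vector_transpose_matrix)

text \<open>Eigenvectors for distinct eigenvalues are orthogonal, and pairwise orthogonal nonzero
  vectors form a finite set. Finiteness is what gives \<open>Max\<close> and \<open>Min\<close> in
  \<open>lambda_max\<close> and \<open>lambda_min\<close> their meaning.\<close>

lemma finite_eigenvalues_symmetric:
  fixes A :: "real ^ 'n ^ 'n"
  assumes "transpose A = A"
  shows "finite {l. eigenvalue_of A l}"
proof -
  obtain v where v: "\<And>l. eigenvalue_of A l \<Longrightarrow> v l \<noteq> 0 \<and> A *v v l = l *\<^sub>R v l"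
    using choice[of "\<lambda>l v. eigenvalue_of A l \<longrightarrow> v \<noteq> 0 \<and> A *v v = l *\<^sub>R v"]
    unfolding eigenvalue_of_def by blast
  let ?S = "{l. eigenvalue_of A l}"
  have orth: "v l \<bullet> v m = 0" if "l \<in> ?S" "m \<in> ?S" "l \<noteq> m" for l m
  proof -
    have "m * (v l \<bullet> v m) = l * (v l \<bullet> v m)"
      using symmetric_matrix_inner[OF assms, of "v l" "v m"] v that by simp
    then show ?thesis using that by simp
  qed
  have "inj_on v ?S"
  proof (rule inj_onI, rule ccontr)
    fix l m assume "l \<in> ?S" "m \<in> ?S" "v l = v m" "l \<noteq> m"
    then show False using orth[of l m] v[of m] by simp
  qed
  moreover have "pairwise orthogonal (v ` ?S)"
    unfolding pairwise_def orthogonal_def using orth by blast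
  then have "finite (v ` ?S)"
    using v pairwise_orthogonal_imp_finite by blast
  ultimately show ?thesis by (simp add: finite_image_iff)
qed

text \<open>First-order condition for a minimum at t = 0: otherwise, for small t of sign opposite to
  b, the linear term would win.\<close>

lemma nonneg_quadratic_linear_coeff_0:
  fixes b c :: real
  assumes "\<And>t. 0 \<le> 2 * t * b + t\<^sup>2 * c"
  shows "b = 0"
proof (rule ccontr)
  assume "b \<noteq> 0"
  \<comment> \<open>This s gives s * \<bar>c\<bar> < 1, so that at t = - s * b the expression s *
    b^2 * (s * c - 2) is negative.\<close>
  define s where "s = 1 / (\<bar>c\<bar> + 1)"
  have s: "s > 0" "s * (\<bar>c\<bar> + 1) = 1" unfolding s_def by auto
  have "s * \<bar>c\<bar> < 1" using s by (simp add: algebra_simps)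
  then have "s * c < 1" using s(1) by (smt (verit) mult_left_mono abs_ge_self)
  have "0 \<le> 2 * (- s * b) * b + (- s * b)\<^sup>2 * c" by (rule assms)
  then have "0 \<le> s * b\<^sup>2 * (s * c - 2)" by (simp add: power2_eq_square algebra_simps)
  moreover have "s * b\<^sup>2 > 0" using s \<open>b \<noteq> 0\<close> by simp
  ultimately have "0 \<le> s * c - 2" by (metis mult_pos_neg not_le)
  with \<open>s * c < 1\<close> show False by linarith
qed

text \<open>Variational argument: the quadratic form attains its minimum on the compact unit sphere,
  and a minimizer is an eigenvector.\<close>

lemma symmetric_matrix_min_eigenvalue:
  fixes A :: "real ^ 'n ^ 'n"
  assumes "transpose A = A"
  shows "\<exists>l. eigenvalue_of A l \<and> (\<forall>x. l * (norm x)\<^sup>2 \<le> x \<bullet> (A *v x))"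
proof -
  have "continuous_on (sphere 0 1) (\<lambda>x. x \<bullet> (A *v x))"
    by (intro continuous_intros linear_continuous_on matrix_vector_mul_bounded_linear)
  moreover have "axis (undefined::'n) (1::real) \<in> sphere 0 1" by simp
  ultimately obtain v where v: "v \<in> sphere 0 1" and
    min: "\<And>x. x \<in> sphere 0 1 \<Longrightarrow> v \<bullet> (A *v v) \<le> x \<bullet> (A *v x)"
    using continuous_attains_inf[OF compact_sphere] by blast
  define l where "l = v \<bullet> (A *v v)"
  have ray: "l * (norm x)\<^sup>2 \<le> x \<bullet> (A *v x)" for x
  proof (cases "x = 0")
    case False
    then have "l \<le> (x /\<^sub>R norm x) \<bullet> (A *v (x /\<^sub>R norm x))"
      unfolding l_def by (intro min) simp
    also have "\<dots> = (x \<bullet> (A *v x)) / (norm x)\<^sup>2"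
      by (simp add: matrix_vector_mult_scaleR power2_eq_square field_simps)
    finally show ?thesis using False by (simp add: field_simps)
  qed simp
  \<comment> \<open>The form x \<bullet> (A *v x) - l * (x \<bullet> x) is nonnegative and vanishes
    at v. Along v + t w its linear coefficient must vanish for every direction w.\<close>
  have "w \<bullet> (A *v v - l *\<^sub>R v) = 0" for w
  proof (rule nonneg_quadratic_linear_coeff_0)
    fix t :: real
    have vv: "v \<bullet> v = 1" using v by (simp add: dot_square_norm)
    have "0 \<le> (v + t *\<^sub>R w) \<bullet> (A *v (v + t *\<^sub>R w)) - l * ((v + t *\<^sub>R w) \<bullet> (v + t *\<^sub>R w))"
      using ray[of "v + t *\<^sub>R w"] by (simp add: power2_norm_eq_inner)
    also have "\<dots> = 2 * t * (w \<bullet> (A *v v - l *\<^sub>R v)) + t\<^sup>2 * (w \<bullet> (A *v w) - l * (w \<bullet> w))"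
      using symmetric_matrix_inner[OF assms, of v w] vv l_def
      by (simp add: matrix_vector_mult_scaleR matrix_vector_right_distrib inner_add_left
          inner_add_right inner_diff_right inner_commute algebra_simps power2_eq_square)
    finally show "0 \<le> 2 * t * (w \<bullet> (A *v v - l *\<^sub>R v)) + t\<^sup>2 * (w \<bullet> (A *v w) - l * (w \<bullet> w))" .
  qed
  then have "A *v v = l *\<^sub>R v" by (metis eq_iff_diff_eq_0 inner_eq_zero_iff)
  moreover have "v \<noteq> 0" using v by auto
  ultimately show ?thesis using ray unfolding eigenvalue_of_def by blast
qed

lemma lambda_min_le_rayleigh:
  fixes A :: "real ^ 'n ^ 'n"
  assumes "transpose A = A"
  shows "lambda_min A * (norm x)\<^sup>2 \<le> x \<bullet> (A *v x)"
proof -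
  obtain l where l: "eigenvalue_of A l" "l * (norm x)\<^sup>2 \<le> x \<bullet> (A *v x)"
    using symmetric_matrix_min_eigenvalue[OF assms] by blast
  have "lambda_min A \<le> l"
    unfolding lambda_min_def using l finite_eigenvalues_symmetric[OF assms] by (intro Min_le) auto
  then show ?thesis using l(2) by (smt (verit) mult_right_mono zero_le_power2)
qed

text \<open>The minimum principle applied to - A, whose eigenvalues are the negatives of those of
  A.\<close>

lemma rayleigh_le_lambda_max:
  fixes A :: "real ^ 'n ^ 'n"
  assumes "transpose A = A"
  shows "x \<bullet> (A *v x) \<le> lambda_max A * (norm x)\<^sup>2"
proof -
  have neg: "(- A) *v y = - (A *v y)" for y
    by (simp add: matrix_vector_mult_def vec_eq_iff sum_negf)
  have "transpose (- A) = - A" using assms by (simp add: transpose_def vec_eq_iff)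
  then obtain l where l: "eigenvalue_of (- A) l" "l * (norm x)\<^sup>2 \<le> x \<bullet> ((- A) *v x)"
    using symmetric_matrix_min_eigenvalue by blast
  have "eigenvalue_of A (- l)"
    using l(1) unfolding eigenvalue_of_def neg by (metis minus_equation_iff scaleR_minus_left)
  then have "- l \<le> lambda_max A"
    unfolding lambda_max_def using finite_eigenvalues_symmetric[OF assms] by (intro Max_ge) auto
  then have "- l * (norm x)\<^sup>2 \<le> lambda_max A * (norm x)\<^sup>2" by (intro mult_right_mono) auto
  then show ?thesis using l(2) by (simp add: neg)
qed

lemma inner_gram_matrix:
  fixes L :: "real ^ 'n ^ 'm"
  shows "x \<bullet> ((transpose L ** L) *v x) = (norm (L *v x))\<^sup>2"
  by (metis dot_lmul_matrix matrix_vector_mul_assoc power2_norm_eq_inner vector_transpose_matrix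
      transpose_transpose)

lemma transpose_gram_matrix:
  fixes L :: "real ^ 'n ^ 'm"
  shows "transpose (transpose L ** L) = transpose L ** L"
  by (simp add: matrix_transpose_mul)

lemma norm_matrix_vector_le_M_L:
  assumes "k \<in> {1..K}"
  shows "(norm (L k *v x))\<^sup>2 \<le> M_L K L * (norm x)\<^sup>2"
proof -
  have "lambda_max (transpose (L k) ** L k) \<le> M_L K L"
    unfolding M_L_def using assms by (intro Max_ge) auto
  then show ?thesis
    using rayleigh_le_lambda_max[OF transpose_gram_matrix, of x "L k"]
    by (smt (verit) inner_gram_matrix mult_right_mono zero_le_power2)
qed

lemma m_L_le_norm_matrix_vector:
  assumes "k \<in> {1..K}"
  shows "m_L K L * (norm x)\<^sup>2 \<le> (norm (L k *v x))\<^sup>2"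
proof -
  have "m_L K L \<le> lambda_min (transpose (L k) ** L k)"
    unfolding m_L_def using assms by (intro Min_le) auto
  then show ?thesis
    using lambda_min_le_rayleigh[OF transpose_gram_matrix, of "L k" x]
    by (smt (verit) inner_gram_matrix mult_right_mono zero_le_power2)
qed

text \<open>Both bounds are tested on a unit vector. The purpose is to obtain \<open>M_L K L\<close>
  \<ge> 0 from the positivity of \<open>m_L K L\<close>.\<close>

lemma m_L_le_M_L:
  fixes L :: "nat \<Rightarrow> real ^ 'n ^ 'n"
  assumes "K \<ge> 1"
  shows "m_L K L \<le> M_L K L"
proof -
  let ?e = "axis (undefined::'n) (1::real)"
  have "m_L K L * (norm ?e)\<^sup>2 \<le> M_L K L * (norm ?e)\<^sup>2"
    using m_L_le_norm_matrix_vector[of 1 K L ?e] norm_matrix_vector_le_M_L[of 1 K L ?e] assms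
    by simp
  then show ?thesis by simp
qed

section \<open>Quadratic growth of a layer\<close>

text \<open>Expand (\<epsilon> * norm u - norm w)^2 / \<epsilon> \<ge> 0. The absolute value makes
  the estimate serve both the upper and the lower bound.\<close>

lemma young_inner:
  fixes u w :: "'a::real_inner"
  assumes "\<epsilon> > 0"
  shows "\<bar>2 * (u \<bullet> w)\<bar> \<le> \<epsilon> * (norm u)\<^sup>2 + (norm w)\<^sup>2 / \<epsilon>"
proof -
  have "0 \<le> (\<epsilon> * norm u - norm w)\<^sup>2 / \<epsilon>" using assms by simp
  also have "\<dots> = \<epsilon> * (norm u)\<^sup>2 + (norm w)\<^sup>2 / \<epsilon> - 2 * (norm u * norm w)"
    using assms by (simp add: power2_eq_square field_simps)
  finally show ?thesis using Cauchy_Schwarz_ineq2[of u w] by simp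
qed

lemma norm_add_square_le:
  fixes u w :: "'a::real_inner"
  assumes "\<epsilon> > 0"
  shows "(norm (u + w))\<^sup>2 \<le> (1 + \<epsilon>) * (norm u)\<^sup>2 + (1 + 1 / \<epsilon>) * (norm w)\<^sup>2"
  using young_inner[OF assms, of u w]
  by (simp add: power2_norm_eq_inner inner_add inner_commute algebra_simps)

text \<open>For \<epsilon> < 1 the coefficient 1 - 1 / \<epsilon> is negative. This does no harm
  later: w is the fixed shift, so the term joins an additive constant of arbitrary sign.\<close>

lemma norm_add_square_ge:
  fixes u w :: "'a::real_inner"
  assumes "\<epsilon> > 0"
  shows "(norm (u + w))\<^sup>2 \<ge> (1 - \<epsilon>) * (norm u)\<^sup>2 + (1 - 1 / \<epsilon>) * (norm w)\<^sup>2"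
  using young_inner[OF assms, of u w]
  by (simp add: power2_norm_eq_inner inner_add inner_commute algebra_simps)

lemma norm_vec_square: "(norm (x :: real ^ 'n))\<^sup>2 = (\<Sum>i\<in>UNIV. (x $ i)\<^sup>2)"
  unfolding power2_norm_eq_inner inner_vec_def by (simp add: power2_eq_square)

lemma norm_layer_square_le:
  fixes T :: "'n::finite \<Rightarrow> real \<Rightarrow> real"
  assumes "\<And>i y. (T i y)\<^sup>2 \<le> C * y\<^sup>2 + C'"
  shows "(norm (layer T L \<mu> x))\<^sup>2 \<le> C * (norm (L *v x + \<mu>))\<^sup>2 + real CARD('n) * C'"
proof -
  have "(norm (layer T L \<mu> x))\<^sup>2 \<le> (\<Sum>i\<in>UNIV. C * ((L *v x + \<mu>) $ i)\<^sup>2 + C')"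
    unfolding norm_vec_square layer_def vec_lambda_beta by (intro sum_mono assms)
  also have "\<dots> = C * (norm (L *v x + \<mu>))\<^sup>2 + real CARD('n) * C'"
    unfolding norm_vec_square by (simp add: sum.distrib sum_distrib_left)
  finally show ?thesis .
qed

lemma norm_layer_square_ge:
  fixes T :: "'n::finite \<Rightarrow> real \<Rightarrow> real"
  assumes "\<And>i y. c * y\<^sup>2 + c' \<le> (T i y)\<^sup>2"
  shows "c * (norm (L *v x + \<mu>))\<^sup>2 + real CARD('n) * c' \<le> (norm (layer T L \<mu> x))\<^sup>2"
proof -
  have "c * (norm (L *v x + \<mu>))\<^sup>2 + real CARD('n) * c' = (\<Sum>i\<in>UNIV. c * ((L *v x + \<mu>) $ i)\<^sup>2 + c')"
    unfolding norm_vec_square by (simp add: sum.distrib sum_distrib_left)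
  also have "\<dots> \<le> (norm (layer T L \<mu> x))\<^sup>2"
    unfolding norm_vec_square layer_def vec_lambda_beta by (intro sum_mono assms)
  finally show ?thesis .
qed

lemma quadratic_upper_bound_compose:
  fixes f :: "'a \<Rightarrow> real"
  assumes "\<And>x. f x \<le> a * g x + a'" "\<And>x. g x \<le> b * h x + b'" "0 \<le> a"
  shows "f x \<le> a * b * h x + (a * b' + a')"
proof -
  have "a * g x \<le> a * (b * h x + b')" using assms by (intro mult_left_mono) auto
  then show ?thesis using assms(1)[of x] by (simp add: algebra_simps)
qed

lemma quadratic_lower_bound_compose:
  fixes f :: "'a \<Rightarrow> real"
  assumes "\<And>x. a * g x + a' \<le> f x" "\<And>x. b * h x + b' \<le> g x" "0 \<le> a"
  shows "a * b * h x + (a * b' + a') \<le> f x"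
proof -
  have "a * (b * h x + b') \<le> a * g x" using assms by (intro mult_left_mono) auto
  then show ?thesis using assms(1)[of x] by (simp add: algebra_simps)
qed

text \<open>Every layer multiplies the leading coefficient by (1 + \<epsilon>) * C *
  \<open>M_L K L\<close>. The bound is stated for all k \<le> K because the derivative estimates use
  it at intermediate layers.\<close>

lemma layers_upper_bound:
  fixes T :: "nat \<Rightarrow> 'n::finite \<Rightarrow> real \<Rightarrow> real"
  assumes T: "\<And>k i y. k \<in> {1..K} \<Longrightarrow> (T k i y)\<^sup>2 \<le> C * y\<^sup>2 + C'"
    and "C \<ge> 0" "M_L K L \<ge> 0" "\<epsilon> > 0" "k \<le> K"
  shows "\<exists>C''. \<forall>x. (norm (layers T L \<mu> k x))\<^sup>2 \<le> C_star \<epsilon> C (M_L K L) k * (norm x)\<^sup>2 + C''"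
  using \<open>k \<le> K\<close>
proof (induction k)
  case 0
  show ?case by (rule exI[of _ 0]) (simp add: C_star_def)
next
  case (Suc k)
  let ?M = "M_L K L"
  obtain D where D: "\<And>x. (norm (layers T L \<mu> k x))\<^sup>2 \<le> C_star \<epsilon> C ?M k * (norm x)\<^sup>2 + D"
    using Suc by auto
  have k: "Suc k \<in> {1..K}" using Suc.prems by simp
  let ?m = "(1 + 1 / \<epsilon>) * (norm (\<mu> (Suc k)))\<^sup>2"
  have L: "(norm (L (Suc k) *v y + \<mu> (Suc k)))\<^sup>2 \<le> (1 + \<epsilon>) * (?M * (norm y)\<^sup>2) + ?m" for y
    using norm_add_square_le[OF \<open>\<epsilon> > 0\<close>, of "L (Suc k) *v y" "\<mu> (Suc k)"]
      mult_left_mono[OF norm_matrix_vector_le_M_L[OF k, of L y], of "1 + \<epsilon>"] assms by linarith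
  have "(norm (layer (T (Suc k)) (L (Suc k)) (\<mu> (Suc k)) y))\<^sup>2
      \<le> C * ((1 + \<epsilon>) * ?M) * (norm y)\<^sup>2 + (C * ?m + real CARD('n) * C')" for y
    by (rule quadratic_upper_bound_compose[OF norm_layer_square_le[OF T[OF k]]])
      (use L assms in \<open>auto simp: mult.assoc\<close>)
  \<comment> \<open>The bound for a single layer is taken at y =
    \<open>layers T L \<mu> k x\<close>.\<close>
  from quadratic_upper_bound_compose[OF this D]
  have "(norm (layers T L \<mu> (Suc k) x))\<^sup>2
      \<le> C * ((1 + \<epsilon>) * ?M) * C_star \<epsilon> C ?M k * (norm x)\<^sup>2
        + (C * ((1 + \<epsilon>) * ?M) * D + (C * ?m + real CARD('n) * C'))" for x
    using assms by simp
  moreover have "C * ((1 + \<epsilon>) * ?M) * C_star \<epsilon> C ?M k = C_star \<epsilon> C ?M (Suc k)"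
    by (simp add: C_star_def mult_ac)
  ultimately show ?case by auto
qed

text \<open>The same induction from below; \<epsilon> < 1 keeps the factor 1 - \<epsilon>
  nonnegative, so that lower bounds can be multiplied by it.\<close>

lemma layers_lower_bound:
  fixes T :: "nat \<Rightarrow> 'n::finite \<Rightarrow> real \<Rightarrow> real"
  assumes T: "\<And>k i y. k \<in> {1..K} \<Longrightarrow> c * y\<^sup>2 + c' \<le> (T k i y)\<^sup>2"
    and "c \<ge> 0" "m_L K L \<ge> 0" "\<epsilon> > 0" "\<epsilon> < 1" "k \<le> K"
  shows "\<exists>c''. \<forall>x. ((1 - \<epsilon>) * c * m_L K L) ^ k * (norm x)\<^sup>2 + c'' \<le> (norm (layers T L \<mu> k x))\<^sup>2"
  using \<open>k \<le> K\<close>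
proof (induction k)
  case 0
  show ?case by (rule exI[of _ 0]) simp
next
  case (Suc k)
  let ?M = "m_L K L"
  obtain D where D: "\<And>x. ((1 - \<epsilon>) * c * ?M) ^ k * (norm x)\<^sup>2 + D \<le> (norm (layers T L \<mu> k x))\<^sup>2"
    using Suc by auto
  have k: "Suc k \<in> {1..K}" using Suc.prems by simp
  let ?m = "(1 - 1 / \<epsilon>) * (norm (\<mu> (Suc k)))\<^sup>2"
  have L: "(1 - \<epsilon>) * (?M * (norm y)\<^sup>2) + ?m \<le> (norm (L (Suc k) *v y + \<mu> (Suc k)))\<^sup>2" for y
    using norm_add_square_ge[OF \<open>\<epsilon> > 0\<close>, of "L (Suc k) *v y" "\<mu> (Suc k)"]
      mult_left_mono[OF m_L_le_norm_matrix_vector[OF k, of L y], of "1 - \<epsilon>"] assms by linarith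
  have "c * ((1 - \<epsilon>) * ?M) * (norm y)\<^sup>2 + (c * ?m + real CARD('n) * c')
      \<le> (norm (layer (T (Suc k)) (L (Suc k)) (\<mu> (Suc k)) y))\<^sup>2" for y
    by (rule quadratic_lower_bound_compose[OF norm_layer_square_ge[OF T[OF k]]])
      (use L assms in \<open>auto simp: mult.assoc\<close>)
  from quadratic_lower_bound_compose[OF this D]
  have "c * ((1 - \<epsilon>) * ?M) * ((1 - \<epsilon>) * c * ?M) ^ k * (norm x)\<^sup>2
        + (c * ((1 - \<epsilon>) * ?M) * D + (c * ?m + real CARD('n) * c'))
      \<le> (norm (layers T L \<mu> (Suc k) x))\<^sup>2" for x
    using assms by simp
  moreover have "c * ((1 - \<epsilon>) * ?M) * ((1 - \<epsilon>) * c * ?M) ^ k = ((1 - \<epsilon>) * c * ?M) ^ Suc k"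
    by (simp add: mult_ac)
  ultimately show ?case by auto
qed

section \<open>Partial derivatives\<close>

text \<open>Chain rule along the line t \<mapsto> x + t e_i. It reduces the rules for
  \<open>partial_deriv\<close> to those for Frechet derivatives.\<close>

lemma partial_deriv_has_derivative:
  assumes "(f has_derivative f') (at x)"
  shows "partial_deriv i f x = f' (axis i 1)"
proof -
  have "((\<lambda>t. x + t *\<^sub>R axis i 1) has_derivative (\<lambda>t. t *\<^sub>R axis i 1)) (at 0)"
    by (auto intro!: derivative_eq_intros)
  then have "((\<lambda>t. f (x + t *\<^sub>R axis i 1)) has_derivative (\<lambda>t. f' (t *\<^sub>R axis i 1))) (at 0)"
    using assms by (auto dest: has_derivative_compose)
  moreover have "f' (t *\<^sub>R axis i 1) = f' (axis i 1) * t" for t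
    using linear_cmul[OF has_derivative_linear[OF assms], of t] by simp
  ultimately have "((\<lambda>t. f (x + t *\<^sub>R axis i 1)) has_field_derivative f' (axis i 1)) (at 0)"
    by (simp add: has_field_derivative_def)
  then show ?thesis unfolding partial_deriv_def by (rule DERIV_imp_deriv)
qed

lemma partial_deriv_frechet:
  "f differentiable (at x) \<Longrightarrow> partial_deriv i f x = frechet_derivative f (at x) (axis i 1)"
  by (simp add: partial_deriv_has_derivative frechet_derivative_works)

lemma partial_deriv_add:
  assumes "f differentiable (at x)" "g differentiable (at x)"
  shows "partial_deriv i (\<lambda>x. f x + g x) x = partial_deriv i f x + partial_deriv i g x"
  using partial_deriv_has_derivative[OF has_derivative_add[OF assms[unfolded frechet_derivative_works]]]
  by (simp add: partial_deriv_frechet assms)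

lemma partial_deriv_mult:
  assumes "f differentiable (at x)" "g differentiable (at x)"
  shows "partial_deriv i (\<lambda>x. f x * g x) x = partial_deriv i f x * g x + f x * partial_deriv i g x"
  using partial_deriv_has_derivative[OF has_derivative_mult[OF assms[unfolded frechet_derivative_works]]]
  by (simp add: partial_deriv_frechet assms)

lemma partial_deriv_const: "partial_deriv i (\<lambda>x. c) = (\<lambda>x. 0)"
  by (simp add: partial_deriv_def fun_eq_iff)

lemma partial_deriv_compose:
  assumes "h differentiable (at (g x))" "g differentiable (at x)"
  shows "partial_deriv i (\<lambda>x. h (g x)) x = deriv h (g x) * partial_deriv i g x"
proof -
  have "(h has_derivative (*) (deriv h (g x))) (at (g x))"
    using assms(1) by (metis DERIV_deriv_iff_real_differentiable has_field_derivative_def)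
  from has_derivative_compose[OF assms(2)[unfolded frechet_derivative_works] this]
  show ?thesis by (simp add: partial_deriv_has_derivative partial_deriv_frechet assms)
qed

section \<open>Exponential growth of iterated derivatives\<close>

definition exp_growth :: "real \<Rightarrow> (real ^ 'n::finite \<Rightarrow> real) \<Rightarrow> bool" where
  "exp_growth A f \<longleftrightarrow> (\<exists>B. \<forall>x. \<bar>f x\<bar> \<le> B * exp (A * (norm x)\<^sup>2))"

text \<open>\<open>derivs_growth n M A f\<close>: for \<open>j \<le> n\<close>, the derivatives of order \<open>j\<close> are of order
  \<open>exp ((A + j M) \<parallel>x\<parallel>\<^sup>2)\<close>.\<close>

primrec derivs_growth :: "nat \<Rightarrow> real \<Rightarrow> real \<Rightarrow> (real ^ 'n::finite \<Rightarrow> real) \<Rightarrow> bool" where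
  "derivs_growth 0 M A f \<longleftrightarrow> exp_growth A f"
| "derivs_growth (Suc n) M A f \<longleftrightarrow>
     exp_growth A f \<and> (\<forall>x. f differentiable (at x)) \<and>
     (\<forall>i. derivs_growth n M (A + M) (partial_deriv i f))"

section \<open>Closure properties of the growth classes\<close>

lemma exp_growth_mono:
  assumes "exp_growth A f" "A \<le> A'"
  shows "exp_growth A' f"
proof -
  obtain B where B: "\<And>x. \<bar>f x\<bar> \<le> B * exp (A * (norm x)\<^sup>2)" using assms unfolding exp_growth_def by blast
  \<comment> \<open>At x = 0 the exponential is 1, which forces B \<ge> 0.\<close>
  have "\<bar>f 0\<bar> \<le> B" using B[of 0] by simp
  then have "B * exp (A * (norm x)\<^sup>2) \<le> B * exp (A' * (norm x)\<^sup>2)" for x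
    using assms(2) by (intro mult_left_mono) (auto intro: mult_right_mono)
  then show ?thesis using B unfolding exp_growth_def by (meson order_trans)
qed

text \<open>The exponent A + j M is affine in the order j, so comparing it at the endpoints j = 0
  and j = n compares it at every order between. In particular a slope can be traded for a larger
  constant exponent.\<close>

lemma derivs_growth_weaken:
  "derivs_growth n M A f \<Longrightarrow> A + n * M \<le> A' + n * M' \<Longrightarrow> A \<le> A' \<Longrightarrow> derivs_growth n M' A' f"
proof (induction n arbitrary: A A' f)
  case 0
  then show ?case using exp_growth_mono by auto
next
  case (Suc n)
  have "A + M \<le> A' + M'"
  proof -
    \<comment> \<open>Order 1 is the convex combination of the endpoints n + 1 and 0 with weights 1
      / (n + 1) and n / (n + 1).\<close>
    have "(A + Suc n * M) + n * A \<le> (A' + Suc n * M') + n * A'"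
      using Suc.prems mult_left_mono[of A A' "real n"] by linarith
    then have "Suc n * (A + M) \<le> Suc n * (A' + M')" by (simp add: algebra_simps)
    then show ?thesis by (simp only: mult_le_cancel_left_pos of_nat_0_less_iff zero_less_Suc)
  qed
  then have "derivs_growth n M' (A' + M') (partial_deriv i f)" for i
    using Suc.IH[of "A + M" "partial_deriv i f" "A' + M'"] Suc.prems by (auto simp: algebra_simps)
  then show ?case using Suc.prems exp_growth_mono[of A f A'] by simp
qed

lemma derivs_growth_SucD: "derivs_growth (Suc n) M A f \<Longrightarrow> derivs_growth n M A f"
  by (induction n arbitrary: A f) auto

lemma derivs_growth_imp_exp_growth: "derivs_growth n M A f \<Longrightarrow> exp_growth A f"
  by (cases n) auto

lemma exp_growth_const:
  assumes "0 \<le> A"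
  shows "exp_growth A (\<lambda>x. c)"
  unfolding exp_growth_def
proof (intro exI allI)
  show "\<bar>c\<bar> \<le> \<bar>c\<bar> * exp (A * (norm x)\<^sup>2)" for x :: "real ^ 'a"
    using assms mult_left_mono[of 1 "exp (A * (norm x)\<^sup>2)" "\<bar>c\<bar>"] by simp
qed

lemma derivs_growth_const: "0 \<le> A \<Longrightarrow> derivs_growth n 0 A (\<lambda>x. c)"
  by (induction n arbitrary: c) (simp_all add: exp_growth_const partial_deriv_const)

lemma exp_growth_add:
  assumes "exp_growth A f" "exp_growth A g"
  shows "exp_growth A (\<lambda>x. f x + g x)"
proof -
  obtain B B' where "\<And>x. \<bar>f x\<bar> \<le> B * exp (A * (norm x)\<^sup>2)"
    "\<And>x. \<bar>g x\<bar> \<le> B' * exp (A * (norm x)\<^sup>2)" using assms unfolding exp_growth_def by blast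
  then have "\<bar>f x + g x\<bar> \<le> (B + B') * exp (A * (norm x)\<^sup>2)" for x
    unfolding distrib_right by (meson abs_triangle_ineq add_mono order_trans)
  then show ?thesis unfolding exp_growth_def by blast
qed

lemma exp_growth_mult:
  assumes "exp_growth A f" "exp_growth A' g"
  shows "exp_growth (A + A') (\<lambda>x. f x * g x)"
proof -
  obtain B B' where B: "\<And>x. \<bar>f x\<bar> \<le> B * exp (A * (norm x)\<^sup>2)"
    "\<And>x. \<bar>g x\<bar> \<le> B' * exp (A' * (norm x)\<^sup>2)" using assms unfolding exp_growth_def by blast
  have "\<bar>f x * g x\<bar> \<le> (B * B') * exp ((A + A') * (norm x)\<^sup>2)" for x
  proof -
    have "\<bar>f x\<bar> * \<bar>g x\<bar> \<le> (B * exp (A * (norm x)\<^sup>2)) * (B' * exp (A' * (norm x)\<^sup>2))"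
      by (intro mult_mono' B) auto
    then show ?thesis by (simp add: abs_mult distrib_right exp_add mult_ac)
  qed
  then show ?thesis unfolding exp_growth_def by blast
qed

lemma derivs_growth_add:
  "derivs_growth n M A f \<Longrightarrow> derivs_growth n M A g \<Longrightarrow> derivs_growth n M A (\<lambda>x. f x + g x)"
proof (induction n arbitrary: A f g)
  case 0
  then show ?case by (simp add: exp_growth_add)
next
  case (Suc n)
  have "partial_deriv i (\<lambda>x. f x + g x) = (\<lambda>x. partial_deriv i f x + partial_deriv i g x)" for i
    using Suc.prems by (auto simp: partial_deriv_add)
  then show ?case using Suc by (simp add: exp_growth_add)
qed

text \<open>Induction by the product rule. All derivatives of g share the exponent A', so only
  differentiating f raises the exponent and the product keeps the slope M.\<close>

lemma derivs_growth_mult: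
  "derivs_growth n M A f \<Longrightarrow> derivs_growth n 0 A' g \<Longrightarrow> 0 \<le> M \<Longrightarrow>
    derivs_growth n M (A + A') (\<lambda>x. f x * g x)"
proof (induction n arbitrary: A f g)
  case (Suc n)
  have f: "derivs_growth n M A f" and g: "derivs_growth n 0 A' g"
    using Suc.prems derivs_growth_SucD by blast+
  have "exp_growth (A + A') (\<lambda>x. f x * g x)"
    using Suc.IH[OF f g] Suc.prems derivs_growth_imp_exp_growth by blast
  moreover have "derivs_growth n M (A + A' + M)
      (\<lambda>x. partial_deriv i f x * g x + f x * partial_deriv i g x)" for i
  proof (rule derivs_growth_add)
    show "derivs_growth n M (A + A' + M) (\<lambda>x. partial_deriv i f x * g x)"
      using Suc.IH[of "A + M" "partial_deriv i f" g] g Suc.prems by (simp add: algebra_simps)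
    \<comment> \<open>Here the derivative falls on g and leaves the exponent at A + A'; the missing
      M is added by weakening.\<close>
    have "derivs_growth n M (A + A') (\<lambda>x. f x * partial_deriv i g x)"
      using Suc.IH[of A f "partial_deriv i g"] f Suc.prems by simp
    then show "derivs_growth n M (A + A' + M) (\<lambda>x. f x * partial_deriv i g x)"
      using Suc.prems by (auto intro: derivs_growth_weaken)
  qed
  moreover have "partial_deriv i (\<lambda>x. f x * g x) =
      (\<lambda>x. partial_deriv i f x * g x + f x * partial_deriv i g x)" for i
    using Suc.prems by (auto simp: partial_deriv_mult)
  ultimately show ?case using Suc.prems by simp
next
  case 0
  then show ?case by (simp add: exp_growth_mult)
qed

lemma derivs_growth_sum:
  assumes "finite I" "\<And>j. j \<in> I \<Longrightarrow> derivs_growth n 0 A (f j)" "0 \<le> A"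
  shows "derivs_growth n 0 A (\<lambda>x. \<Sum>j\<in>I. f j x)"
  using assms by (induction I) (auto intro: derivs_growth_const derivs_growth_add)

lemma derivs_growth_cmult:
  assumes "derivs_growth n 0 A f"
  shows "derivs_growth n 0 A (\<lambda>x. c * f x)"
  using derivs_growth_mult[OF derivs_growth_const[of 0 n c] assms] by simp

lemma derivs_growth_imp_times_differentiable:
  "derivs_growth n M A f \<Longrightarrow> times_differentiable_vec n f"
  by (induction n arbitrary: A f) auto

lemma derivs_growth_iterated:
  "derivs_growth n 0 A f \<Longrightarrow> length is \<le> n \<Longrightarrow> derivs_growth (n - length is) 0 A (foldr partial_deriv is f)"
proof (induction "is")
  case (Cons i "is")
  then have "derivs_growth (Suc (n - length (i # is))) 0 A (foldr partial_deriv is f)"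
    by (simp add: Suc_diff_Suc)
  then show ?case by simp
qed simp

section \<open>Composition with a function of one variable\<close>

text \<open>Induction on n for all m at once, since differentiating the m-th derivative of T along g
  brings in the (m+1)-st. The constraint m + n \<le> d keeps every order within the assumed
  bounds.\<close>

lemma derivs_growth_compose:
  fixes T :: "real \<Rightarrow> real"
  assumes bound: "\<And>m. m \<in> {1..d} \<Longrightarrow> exp_growth A (\<lambda>x. (deriv ^^ m) T (g x))"
    and T: "times_differentiable d T" and g: "\<And>x. g differentiable (at x)"
    and dg: "\<And>i. derivs_growth (d - 1) 0 M (partial_deriv i g)"
    and "0 \<le> M"
  shows "1 \<le> m \<Longrightarrow> m + n \<le> d \<Longrightarrow> derivs_growth n M A (\<lambda>x. (deriv ^^ m) T (g x))"
proof (induction n arbitrary: m)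
  case 0
  then show ?case using bound[of m] by simp
next
  case (Suc n)
  \<comment> \<open>The product rule needs both factors at the same order n, so the hypothesis at
    order d - 1 is passed down to smaller orders.\<close>
  have dg': "derivs_growth k 0 M (partial_deriv i g)" if "k \<le> d - 1" for k i
    using inc_induct[of k "d - 1" "\<lambda>k. derivs_growth k 0 M (partial_deriv i g)"] that dg
      derivs_growth_SucD by blast
  have diff: "(deriv ^^ m) T differentiable (at y)" for y
    using T Suc.prems unfolding times_differentiable_def by simp
  have "partial_deriv i (\<lambda>x. (deriv ^^ m) T (g x)) =
      (\<lambda>x. (deriv ^^ Suc m) T (g x) * partial_deriv i g x)" for i
    using partial_deriv_compose[OF diff g] by auto
  moreover have "derivs_growth n M (A + M) (\<lambda>x. (deriv ^^ Suc m) T (g x) * partial_deriv i g x)" for i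
    using Suc.IH[of "Suc m"] Suc.prems dg'[of n i] \<open>0 \<le> M\<close> by (intro derivs_growth_mult) auto
  moreover have "(\<lambda>x. (deriv ^^ m) T (g x)) differentiable (at x)" for x
    using differentiable_compose[OF diff g] .
  ultimately show ?case using bound[of m] Suc.prems by simp
qed

text \<open>The first differentiation yields exponent A + M, and d - 1 further ones add M each. The
  resulting A + d M, used for all orders, is the source of the recursion for
  \<open>M_tau\<close>.\<close>

lemma derivs_growth_layer_coordinate:
  fixes T :: "real \<Rightarrow> real"
  assumes bound: "\<And>m. m \<in> {1..d} \<Longrightarrow> exp_growth A (\<lambda>x. (deriv ^^ m) T (g x))"
    and T: "times_differentiable d T" and g: "\<And>x. g differentiable (at x)"
    and dg: "\<And>i. derivs_growth (d - 1) 0 M (partial_deriv i g)"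
    and "0 \<le> M" "1 \<le> d"
  shows "(\<lambda>x. T (g x)) differentiable (at x)"
    and "derivs_growth (d - 1) 0 (A + d * M) (partial_deriv i (\<lambda>x. T (g x)))"
proof -
  have diff: "T differentiable (at y)" for y
    using T \<open>1 \<le> d\<close> unfolding times_differentiable_def by (metis funpow_0 less_le_trans zero_less_one)
  show "(\<lambda>x. T (g x)) differentiable (at x)"
    using differentiable_compose[OF diff g] .
  have "derivs_growth (d - 1) M A (\<lambda>x. (deriv ^^ 1) T (g x))"
    by (rule derivs_growth_compose[OF bound T g dg \<open>0 \<le> M\<close>]) (use \<open>1 \<le> d\<close> in auto)
  from derivs_growth_mult[OF this dg \<open>0 \<le> M\<close>]
  have "derivs_growth (d - 1) M (A + M) (\<lambda>x. deriv T (g x) * partial_deriv i g x)" by simp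
  moreover have "partial_deriv i (\<lambda>x. T (g x)) = (\<lambda>x. deriv T (g x) * partial_deriv i g x)"
    using partial_deriv_compose[OF diff g] by auto
  ultimately have "derivs_growth (d - 1) M (A + M) (partial_deriv i (\<lambda>x. T (g x)))" by simp
  \<comment> \<open>The slope M is flattened to 0; at the top order d - 1 the two exponents
    coincide.\<close>
  then show "derivs_growth (d - 1) 0 (A + d * M) (partial_deriv i (\<lambda>x. T (g x)))"
  proof (rule derivs_growth_weaken)
    show "A + M + real (d - 1) * M \<le> A + real d * M + real (d - 1) * 0"
      using \<open>1 \<le> d\<close> by (simp add: of_nat_diff algebra_simps)
    show "A + M \<le> A + d * M"
      using \<open>1 \<le> d\<close> \<open>0 \<le> M\<close> mult_right_mono[of 1 "real d" M] by simp
  qed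
qed

section \<open>Propagation of derivative bounds through the layers\<close>

lemma M_tau_nonneg:
  assumes "0 \<le> \<epsilon>" "0 \<le> M" "0 \<le> C" "0 \<le> \<Lambda>"
  shows "0 \<le> M_tau d \<epsilon> M C \<Lambda> k"
  by (induction k) (use assms in \<open>auto simp: C_star_def\<close>)

text \<open>The growth claim starts at first derivatives, whence the order
  \<open>CARD('n) - 1\<close>; the values of the layers are controlled separately by the quadratic
  bound. For k = 0 the partial derivatives are constants, with exponent 0.\<close>

lemma layers_derivs_growth:
  fixes T :: "nat \<Rightarrow> 'n::finite \<Rightarrow> real \<Rightarrow> real"
  assumes diff: "\<And>k i. k \<in> {1..K} \<Longrightarrow> times_differentiable CARD('n) (T k i)"
    and deriv: "\<And>k i m y. k \<in> {1..K} \<Longrightarrow> m \<in> {1..CARD('n)} \<Longrightarrow>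
           \<bar>(deriv ^^ m) (T k i) y\<bar> \<le> B * exp (M * y\<^sup>2)"
    and upper: "\<And>k i y. k \<in> {1..K} \<Longrightarrow> (T k i y)\<^sup>2 \<le> C * y\<^sup>2 + C'"
    and "M \<ge> 0" "C \<ge> 0" "M_L K L \<ge> 0" "\<epsilon> > 0" "k \<le> K"
  shows "(\<forall>i x. (\<lambda>x. layers T L \<mu> k x $ i) differentiable (at x)) \<and>
    (\<forall>i j. derivs_growth (CARD('n) - 1) 0 (M_tau CARD('n) \<epsilon> M C (M_L K L) k)
      (partial_deriv j (\<lambda>x. layers T L \<mu> k x $ i)))"
  using \<open>k \<le> K\<close>
proof (induction k)
  case 0
  have der: "((\<lambda>x::real^'n. x $ i) has_derivative (\<lambda>x. x $ i)) (at x)" for i x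
    by (rule bounded_linear.has_derivative[OF bounded_linear_vec_nth has_derivative_ident])
  then have "partial_deriv j (\<lambda>x::real^'n. x $ i) = (\<lambda>x. axis j 1 $ i)" for i j
    using partial_deriv_has_derivative by blast
  then show ?case using differentiableI[OF der] by (simp add: derivs_growth_const)
next
  case (Suc k)
  let ?d = "CARD('n)" and ?\<tau> = "layers T L \<mu> k" and ?S = "C_star \<epsilon> C (M_L K L) k"
  let ?M = "M_tau ?d \<epsilon> M C (M_L K L) k" and ?A = "(1 + \<epsilon>) * M * M_L K L * C_star \<epsilon> C (M_L K L) k"
  have k: "Suc k \<in> {1..K}" using Suc.prems by simp
  have \<tau>_diff: "(\<lambda>x. ?\<tau> x $ i) differentiable (at x)"
    and \<tau>_growth: "derivs_growth (?d - 1) 0 ?M (partial_deriv j (\<lambda>x. ?\<tau> x $ i))" for i j x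
    using Suc by auto
  have M: "0 \<le> ?M" using assms by (intro M_tau_nonneg) auto
  \<comment> \<open>The argument of the next \<open>T\<close>. It is affine in the previous layers,
    so its partial derivatives are linear combinations of theirs and keep the exponent
    \<open>?M\<close>.\<close>
  define g where "g i x = (L (Suc k) *v ?\<tau> x + \<mu> (Suc k)) $ i" for i x
  have g_eq: "g i = (\<lambda>x. (\<Sum>j\<in>UNIV. L (Suc k) $ i $ j * ?\<tau> x $ j) + \<mu> (Suc k) $ i)" for i
    by (auto simp: g_def matrix_vector_mult_def)
  have g_has: "(g i has_derivative
      (\<lambda>h. \<Sum>j\<in>UNIV. L (Suc k) $ i $ j * frechet_derivative (\<lambda>x. ?\<tau> x $ j) (at x) h)) (at x)" for i x
    unfolding g_eq
    by (rule has_derivative_eq_rhs, rule has_derivative_add[OF has_derivative_sum has_derivative_const])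
      (auto intro!: has_derivative_mult_right \<tau>_diff[unfolded frechet_derivative_works])
  have g_diff: "g i differentiable (at x)" for i x
    using g_has by (auto simp: differentiable_def)
  have "partial_deriv l (g i) = (\<lambda>x. \<Sum>j\<in>UNIV. L (Suc k) $ i $ j * partial_deriv l (\<lambda>x. ?\<tau> x $ j) x)" for i l
    by (simp add: fun_eq_iff partial_deriv_has_derivative[OF g_has] partial_deriv_frechet \<tau>_diff)
  then have g_growth: "derivs_growth (?d - 1) 0 ?M (partial_deriv l (g i))" for i l
    by (simp only:) (intro derivs_growth_sum derivs_growth_cmult \<tau>_growth M finite)
  obtain D where D: "\<And>x. (norm (?\<tau> x))\<^sup>2 \<le> ?S * (norm x)\<^sup>2 + D"
  proof -
    have "\<exists>D. \<forall>x. (norm (?\<tau> x))\<^sup>2 \<le> ?S * (norm x)\<^sup>2 + D"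
      by (rule layers_upper_bound[where C' = C']) (use upper assms Suc.prems in auto)
    then show ?thesis using that by blast
  qed
  \<comment> \<open>E collects the terms free of x. In exp (M * g^2) it contributes only the
    constant factor exp (M * E), and the remaining exponent is \<open>?A\<close>.\<close>
  define E where "E = (1 + \<epsilon>) * M_L K L * D + (1 + 1 / \<epsilon>) * (norm (\<mu> (Suc k)))\<^sup>2"
  have g_bound: "(g i x)\<^sup>2 \<le> (1 + \<epsilon>) * M_L K L * ?S * (norm x)\<^sup>2 + E" for i x
  proof -
    have "(g i x)\<^sup>2 \<le> (norm (L (Suc k) *v ?\<tau> x + \<mu> (Suc k)))\<^sup>2"
      unfolding g_def abs_le_square_iff[symmetric] abs_norm_cancel by (rule component_le_norm_cart)
    also have "\<dots> \<le> (1 + \<epsilon>) * (norm (L (Suc k) *v ?\<tau> x))\<^sup>2 + (1 + 1 / \<epsilon>) * (norm (\<mu> (Suc k)))\<^sup>2"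
      using norm_add_square_le[OF \<open>\<epsilon> > 0\<close>] .
    also have "\<dots> \<le> (1 + \<epsilon>) * (M_L K L * (?S * (norm x)\<^sup>2 + D)) + (1 + 1 / \<epsilon>) * (norm (\<mu> (Suc k)))\<^sup>2"
      using assms
      by (intro add_right_mono mult_left_mono order_trans[OF norm_matrix_vector_le_M_L[OF k]] D) auto
    finally show ?thesis by (simp add: E_def algebra_simps)
  qed
  have T_growth: "exp_growth ?A (\<lambda>x. (deriv ^^ m) (T (Suc k) i) (g i x))" if m: "m \<in> {1..?d}" for i m
  proof -
    have "0 \<le> B"
      using deriv[OF k m, of i 0] by simp
    have "\<bar>(deriv ^^ m) (T (Suc k) i) (g i x)\<bar> \<le> (B * exp (M * E)) * exp (?A * (norm x)\<^sup>2)" for x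
    proof -
      have "M * (g i x)\<^sup>2 \<le> M * ((1 + \<epsilon>) * M_L K L * ?S * (norm x)\<^sup>2 + E)"
        using g_bound \<open>M \<ge> 0\<close> by (rule mult_left_mono)
      then have "exp (M * (g i x)\<^sup>2) \<le> exp (M * E + ?A * (norm x)\<^sup>2)"
        by (simp add: algebra_simps)
      then have "B * exp (M * (g i x)\<^sup>2) \<le> B * exp (M * E + ?A * (norm x)\<^sup>2)"
        using \<open>0 \<le> B\<close> by (rule mult_left_mono)
      then show ?thesis using deriv[OF k m, of i "g i x"] by (simp add: exp_add)
    qed
    then show ?thesis unfolding exp_growth_def by blast
  qed
  have eq: "(\<lambda>x. layers T L \<mu> (Suc k) x $ i) = (\<lambda>x. T (Suc k) i (g i x))" for i
    by (simp add: layer_def g_def)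
  \<comment> \<open>With A = \<open>?A\<close> and M = \<open>?M\<close>, the exponent A + d M is
    \<open>M_tau\<close> at \<open>Suc k\<close>.\<close>
  note concl = derivs_growth_layer_coordinate[OF T_growth diff[OF k] g_diff g_growth M]
  show ?case
    unfolding eq M_tau.simps using concl by simp
qed

section \<open>Multi-index derivatives\<close>

text \<open>A multi-index becomes a word of directions, each i repeated a i times. The word follows
  the order of differentiation in \<open>multi_deriv\<close>, so partial derivatives are never
  interchanged.\<close>

lemma multi_deriv_eq_foldr:
  fixes a :: "'n::{finite,linorder} \<Rightarrow> nat"
  obtains "is" where "length is = (\<Sum>j\<in>UNIV. a j)"
    "\<And>f. multi_deriv a f = foldr partial_deriv is f"
proof
  let ?s = "sorted_list_of_set (UNIV :: 'n set)"
  let ?is = "concat (map (\<lambda>i. replicate (a i) i) ?s)"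
  have "length ?is = (\<Sum>j\<leftarrow>?s. a j)" by (simp add: length_concat o_def)
  then show "length ?is = (\<Sum>j\<in>UNIV. a j)" by (simp add: sum_list_distinct_conv_sum_set)
  have "foldr (\<lambda>i g. (partial_deriv i ^^ a i) g) l f =
      foldr partial_deriv (concat (map (\<lambda>i. replicate (a i) i) l)) f" for l :: "'n list" and f
    by (induction l) (auto simp: foldr_replicate)
  then show "multi_deriv a f = foldr partial_deriv ?is f" for f by (simp add: multi_deriv_def)
qed

text \<open>There are finitely many coordinates and words of length at most n + 1, so their
  individual constants can be summed into a common one.\<close>

lemma multi_deriv_uniform_bound:
  fixes f :: "'n::{finite,linorder} \<Rightarrow> real ^ 'n::{finite,linorder} \<Rightarrow> real"
  assumes "\<And>i j. derivs_growth n 0 A (partial_deriv j (f i))"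
  obtains B where "B \<ge> 0" "\<And>i a x. 1 \<le> (\<Sum>j\<in>UNIV. a j) \<Longrightarrow> (\<Sum>j\<in>UNIV. a j) \<le> Suc n \<Longrightarrow>
    \<bar>multi_deriv a (f i) x\<bar> \<le> B * exp (A * (norm x)\<^sup>2)"
proof -
  let ?P = "(UNIV :: 'n set) \<times> {is. set is \<subseteq> (UNIV :: 'n set) \<and> length is \<le> Suc n}"
  have fin: "finite ?P" by (intro finite_cartesian_product finite_lists_length_le finite)
  have ex: "\<exists>B. \<forall>x. \<bar>foldr partial_deriv is (f i) x\<bar> \<le> B * exp (A * (norm x)\<^sup>2)"
    if "is \<noteq> []" "length is \<le> Suc n" for i "is"
  proof -
    \<comment> \<open>The last letter is the derivative applied first. It is split off because the
      hypothesis concerns \<open>partial_deriv j (f i)\<close>.\<close>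
    obtain js j where js: "is = js @ [j]" using \<open>is \<noteq> []\<close> by (metis rev_exhaust)
    then have "derivs_growth (n - length js) 0 A (foldr partial_deriv is (f i))"
      using derivs_growth_iterated[OF assms[of j i], of js] that by simp
    then show ?thesis using derivs_growth_imp_exp_growth unfolding exp_growth_def by blast
  qed
  define B where "B i is = (SOME B. \<forall>x. \<bar>foldr partial_deriv is (f i) x\<bar> \<le> B * exp (A * (norm x)\<^sup>2))"
    for i "is"
  have B: "\<bar>foldr partial_deriv is (f i) x\<bar> \<le> B i is * exp (A * (norm x)\<^sup>2)"
    if "is \<noteq> []" "length is \<le> Suc n" for i "is" x
    using someI_ex[OF ex[OF that]] unfolding B_def by blast
  show ?thesis
  proof
    \<comment> \<open>The sum also runs over the empty word, where \<open>B\<close> is an arbitrary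
      choice; absolute values make this harmless and let the sum dominate each constant.\<close>
    show "0 \<le> (\<Sum>(i, is)\<in>?P. \<bar>B i is\<bar>)" by (intro sum_nonneg) auto
    fix i :: 'n and a :: "'n \<Rightarrow> nat" and x :: "real ^ 'n::{finite,linorder}"
    assume a: "1 \<le> (\<Sum>j\<in>UNIV. a j)" "(\<Sum>j\<in>UNIV. a j) \<le> Suc n"
    obtain "is" where "is": "length is = (\<Sum>j\<in>UNIV. a j)"
      "multi_deriv a (f i) = foldr partial_deriv is (f i)" using multi_deriv_eq_foldr[of a] by metis
    have "B i is \<le> (\<Sum>(i, is)\<in>?P. \<bar>B i is\<bar>)"
      using member_le_sum[of "(i, is)" ?P "\<lambda>(i, is). \<bar>B i is\<bar>"] fin a "is" by fastforce
    then have "B i is * exp (A * (norm x)\<^sup>2) \<le> (\<Sum>(i, is)\<in>?P. \<bar>B i is\<bar>) * exp (A * (norm x)\<^sup>2)"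
      by (intro mult_right_mono) auto
    moreover have "\<bar>multi_deriv a (f i) x\<bar> \<le> B i is * exp (A * (norm x)\<^sup>2)"
      unfolding "is"(2) using "is"(1) a by (intro B) auto
    ultimately show "\<bar>multi_deriv a (f i) x\<bar> \<le> (\<Sum>(i, is)\<in>?P. \<bar>B i is\<bar>) * exp (A * (norm x)\<^sup>2)"
      by (rule order_trans[rotated])
  qed
qed

theorem proposition2:
  fixes K :: nat
    and T :: "nat \<Rightarrow> 'n::{finite,linorder} \<Rightarrow> real \<Rightarrow> real"
    and L :: "nat \<Rightarrow> real ^ 'n::{finite,linorder} ^ 'n::{finite,linorder}"
    and \<mu> :: "nat \<Rightarrow> real ^ 'n::{finite,linorder}"
    and c\<^sub>T C\<^sub>T M\<^sub>T B\<^sub>T c\<^sub>T' C\<^sub>T' \<epsilon> :: real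
  assumes "K \<ge> 1"
    and "\<And>k i. k \<in> {1..K} \<Longrightarrow> strictly_monotone (T k i)"
    and "\<And>k i. k \<in> {1..K} \<Longrightarrow> times_differentiable CARD('n) (T k i)"
    and "\<And>k. k \<in> {1..K} \<Longrightarrow> lower_triangular (L k)"
    and "c\<^sub>T > 0" "C\<^sub>T > 0" "M\<^sub>T \<ge> 0" "B\<^sub>T \<ge> 0"
    and "\<And>k i m y. k \<in> {1..K} \<Longrightarrow> m \<in> {1..CARD('n)} \<Longrightarrow>
           \<bar>(deriv ^^ m) (T k i) y\<bar> \<le> B\<^sub>T * exp (M\<^sub>T * \<bar>y\<bar>\<^sup>2)"
    and "\<And>k i y. k \<in> {1..K} \<Longrightarrow> c\<^sub>T * \<bar>y\<bar>\<^sup>2 + c\<^sub>T' \<le> \<bar>T k i y\<bar>\<^sup>2"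
    and "\<And>k i y. k \<in> {1..K} \<Longrightarrow> \<bar>T k i y\<bar>\<^sup>2 \<le> C\<^sub>T * \<bar>y\<bar>\<^sup>2 + C\<^sub>T'"
    and "m_L K L > 0"
    and "0 < \<epsilon>" "\<epsilon> < 1"
  defines "\<tau> \<equiv> layers T L \<mu> K"
  shows "\<exists>B\<^sub>\<tau> C\<^sub>\<tau>' c\<^sub>\<tau>'. B\<^sub>\<tau> \<ge> 0 \<and>
    (\<forall>i. times_differentiable_vec CARD('n) (\<lambda>x. \<tau> x $ i)) \<and>
    (\<forall>x.
      (\<forall>i a. 1 \<le> (\<Sum>j\<in>UNIV. a j) \<and> (\<Sum>j\<in>UNIV. a j) \<le> CARD('n) \<longrightarrow>
         \<bar>multi_deriv a (\<lambda>x. \<tau> x $ i) x\<bar>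
           \<le> B\<^sub>\<tau> * exp (M_tau CARD('n) \<epsilon> M\<^sub>T C\<^sub>T (M_L K L) K * (norm x)\<^sup>2)) \<and>
      (norm (\<tau> x))\<^sup>2 \<le> C_star \<epsilon> C\<^sub>T (M_L K L) K * (norm x)\<^sup>2 + C\<^sub>\<tau>' \<and>
      (norm (\<tau> x))\<^sup>2 \<ge> ((1 - \<epsilon>) * c\<^sub>T * m_L K L) ^ K * (norm x)\<^sup>2 + c\<^sub>\<tau>')"
proof -
  let ?M = "M_tau CARD('n) \<epsilon> M\<^sub>T C\<^sub>T (M_L K L) K"
  have d: "Suc (CARD('n) - 1) = CARD('n)" by simp
  have M_L_nonneg: "M_L K L \<ge> 0" using m_L_le_M_L[OF assms(1), of L] assms(12) by linarith
  have deriv: "\<bar>(deriv ^^ m) (T k i) y\<bar> \<le> B\<^sub>T * exp (M\<^sub>T * y\<^sup>2)"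
    if "k \<in> {1..K}" "m \<in> {1..CARD('n)}" for k i m y
    using assms(9)[OF that] by simp
  have lower: "c\<^sub>T * y\<^sup>2 + c\<^sub>T' \<le> (T k i y)\<^sup>2" if "k \<in> {1..K}" for k i y
    using assms(10)[OF that] by simp
  have upper: "(T k i y)\<^sup>2 \<le> C\<^sub>T * y\<^sup>2 + C\<^sub>T'" if "k \<in> {1..K}" for k i y
    using assms(11)[OF that] by simp
  have "(\<forall>i x. (\<lambda>x. \<tau> x $ i) differentiable (at x)) \<and>
      (\<forall>i j. derivs_growth (CARD('n) - 1) 0 ?M (partial_deriv j (\<lambda>x. \<tau> x $ i)))"
    unfolding \<tau>_def
    by (rule layers_derivs_growth[where B = B\<^sub>T and C' = C\<^sub>T'])
      (use assms(3,6,7,13) deriv upper M_L_nonneg in auto)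
  then have diff: "(\<lambda>x. \<tau> x $ i) differentiable (at x)"
    and growth: "derivs_growth (CARD('n) - 1) 0 ?M (partial_deriv j (\<lambda>x. \<tau> x $ i))" for i j x
    by blast+
  \<comment> \<open>One level is unfolded: differentiability of the coordinate itself is
    \<open>diff\<close>, and the growth of its partial derivatives supplies the remaining
    \<open>CARD('n) - 1\<close> orders.\<close>
  have "times_differentiable_vec (Suc (CARD('n) - 1)) (\<lambda>x. \<tau> x $ i)" for i
    unfolding times_differentiable_vec.simps
    by (intro conjI allI diff derivs_growth_imp_times_differentiable[OF growth])
  then have vec: "times_differentiable_vec CARD('n) (\<lambda>x. \<tau> x $ i)" for i by (simp only: d)
  obtain B where B: "B \<ge> 0" "\<And>i a x. 1 \<le> (\<Sum>j\<in>UNIV. a j) \<Longrightarrow> (\<Sum>j\<in>UNIV. a j) \<le> CARD('n) \<Longrightarrow>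
      \<bar>multi_deriv a (\<lambda>x. \<tau> x $ i) x\<bar> \<le> B * exp (?M * (norm x)\<^sup>2)"
    by (rule multi_deriv_uniform_bound[of _ _ "\<lambda>i x. \<tau> x $ i", OF growth, unfolded d]) blast
  have "\<exists>C. \<forall>x. (norm (\<tau> x))\<^sup>2 \<le> C_star \<epsilon> C\<^sub>T (M_L K L) K * (norm x)\<^sup>2 + C"
    unfolding \<tau>_def
    by (rule layers_upper_bound[where C' = C\<^sub>T']) (use assms(6,13) upper M_L_nonneg in auto)
  then obtain C where C: "\<And>x. (norm (\<tau> x))\<^sup>2 \<le> C_star \<epsilon> C\<^sub>T (M_L K L) K * (norm x)\<^sup>2 + C"
    by blast
  have "\<exists>c. \<forall>x. ((1 - \<epsilon>) * c\<^sub>T * m_L K L) ^ K * (norm x)\<^sup>2 + c \<le> (norm (\<tau> x))\<^sup>2"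
    unfolding \<tau>_def
    by (rule layers_lower_bound[where c' = c\<^sub>T']) (use assms(5,12-14) lower in auto)
  then obtain c where c: "\<And>x. ((1 - \<epsilon>) * c\<^sub>T * m_L K L) ^ K * (norm x)\<^sup>2 + c \<le> (norm (\<tau> x))\<^sup>2"
    by blast
  show ?thesis
    using vec B C c by (intro exI[of _ B] exI[of _ C] exI[of _ c]) auto
qed

end
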